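(* Let $\alpha>0$ be a non-integer real number, $m=\lceil\alpha\rceil$, $n\in\mathbb{N}$, and $x>0$. Then $${}_0I_x^{\alpha}\,x^{2n}\ln(x)=\frac{\Gamma(2n+1)}{\Gamma(2n+1+\alpha)}\,x^{\alpha+2n}\Bigl(\ln(x)+\Psi(2n+1)-\Psi(2n+1+\alpha)\Bigr),$$ $${}_0^{C}D_x^{\alpha}\,x^{2n}\ln(x)=\frac{\Gamma(2n+1)}{\Gamma(2n+1-\alpha)}\,x^{2n-\alpha}\left(\ln(x)+\Psi(2n-m+1)-\Psi(2n+1-\alpha)+m!\,\Gamma(2n-m+1)\sum_{r=1}^{m}\frac{(-1)^{r-1}}{r\,(m-r)!\,\Gamma(2n-m+r+1)}\right),$$ $${}_0D_x^{\alpha}\,x^{2n}\ln(x)=\frac{\Gamma(2n+1)}{\Gamma(2n+1-\alpha)}\,x^{2n-\alpha}\left(\ln(x)+\Psi(2n-m+1)-\Psi(2n+1-\alpha)+m!\,\Gamma(2n-m+1)\sum_{r=1}^{m}\frac{(-1)^{r-1}}{r\,(m-r)!\,\Gamma(2n-m+r+1)}\right).$$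
   Context: Throughout, $\alpha>0$ is a non-integer real number and $m=\lceil\alpha\rceil$. For a function $f$ and $x>a$: the left-sided Riemann-Liouville fractional integral of order $\alpha$ is ${}_aI_x^{\alpha}f(x)=\frac{1}{\Gamma(\alpha)}\int_a^x(x-\tau)^{\alpha-1}f(\tau)\,d\tau$; the left-sided Riemann-Liouville fractional derivative of order $\alpha$ is ${}_aD_x^{\alpha}f(x)=\frac{1}{\Gamma(m-\alpha)}\frac{d^m}{dx^m}\int_a^x(x-\tau)^{m-\alpha-1}f(\tau)\,d\tau$; the left-sided Caputo fractional derivative of order $\alpha$ is ${}_a^{C}D_x^{\alpha}f(x)=\frac{1}{\Gamma(m-\alpha)}\int_a^x(x-\tau)^{m-\alpha-1}f^{(m)}(\tau)\,d\tau$. Notation such as ${}_0I_x^{\alpha}\,x^{2n}\ln(x)$ means the operator applied to the function $\tau\mapsto\tau^{2n}\ln(\tau)$, evaluated at $x$. $\Gamma$ is the Gamma function and $\Psi=\Gamma'/\Gamma$ is its logarithmic derivative. The thin-plate spline $x^{2n}\ln(x)$ and its derivatives are assigned their limiting value $0$ at $x=0$.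
   Formalization: The Caputo and Riemann-Liouville derivative formulas are stated only for m ≤ 2n, because for m > 2n the terms Γ(2n−m+1) and Ψ(2n−m+1) are at poles and undefined; the fractional integral formula is stated for all n. *)

theory Defs
  imports "HOL-Analysis.Analysis"
begin

text \<open>
  Left-sided fractional operators of order \<open>\<alpha>\<close> with base point \<open>a\<close>, meant for \<open>a < x\<close> and
  non-integer \<open>\<alpha> > 0\<close>. The integrals are Lebesgue integrals. Where an exponent is negative,
  the value \<open>0 powr _ = 0\<close> of the kernel at \<open>\<tau> = x\<close> is irrelevant, and so is the value of
  \<open>f\<close> or of its derivatives at \<open>\<tau> = a\<close>, since single points are null sets.
\<close>

definition RL_integral :: "real \<Rightarrow> real \<Rightarrow> (real \<Rightarrow> real) \<Rightarrow> real \<Rightarrow> real" where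
  "RL_integral a \<alpha> f x =
     1 / Gamma \<alpha> * (LINT \<tau>:{a..x}|lborel. (x - \<tau>) powr (\<alpha> - 1) * f \<tau>)"

definition RL_deriv :: "real \<Rightarrow> real \<Rightarrow> (real \<Rightarrow> real) \<Rightarrow> real \<Rightarrow> real" where
  "RL_deriv a \<alpha> f x =
     (let m = nat \<lceil>\<alpha>\<rceil> in
        1 / Gamma (real m - \<alpha>) *
        (deriv ^^ m) (\<lambda>y. LINT \<tau>:{a..y}|lborel. (y - \<tau>) powr (real m - \<alpha> - 1) * f \<tau>) x)"

definition Caputo_deriv :: "real \<Rightarrow> real \<Rightarrow> (real \<Rightarrow> real) \<Rightarrow> real \<Rightarrow> real" where
  "Caputo_deriv a \<alpha> f x =
     (let m = nat \<lceil>\<alpha>\<rceil> in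
        1 / Gamma (real m - \<alpha>) *
        (LINT \<tau>:{a..x}|lborel. (x - \<tau>) powr (real m - \<alpha> - 1) * (deriv ^^ m) f \<tau>))"

end

theory Submission
  imports Defs
begin

text \<open>
  The real-exponent spline monomials
  \<open>G\<^sub>c(y) = y\<^sup>c / \<Gamma>(c + 1) \<cdot> (ln y - \<Psi>(c + 1) + A)\<close>, with \<open>A\<close> held fixed, are (up to the
  multiple \<open>A\<close> of the normalised power) the derivative of \<open>y\<^sup>c / \<Gamma>(c + 1)\<close> with respect to the
  exponent \<open>c\<close>. Normalised powers are shifted by fractional calculus, and the shift survives
  differentiation in \<open>c\<close>: the ordinary derivative maps \<open>G\<^sub>c\<close> to \<open>G\<^bsub>c-1\<^esub>\<close>
  (\<open>has_real_derivative_log_power\<close>) and the fractional integral of order \<open>b\<close> maps it to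
  \<open>G\<^bsub>c+b\<^esub>\<close> (\<open>RL_integral_log_power\<close>).
  The thin-plate spline is \<open>\<Gamma>(2n + 1) \<cdot> G\<^bsub>2n\<^esub>\<close> with \<open>A = \<Psi>(2n + 1)\<close>. Hence its fractional
  integral is \<open>\<Gamma>(2n + 1) \<cdot> G\<^bsub>2n+\<alpha>\<^esub>\<close>, and both fractional derivatives, which compose the
  integral of order \<open>m - \<alpha>\<close> with \<open>m\<close> derivatives in either order, give
  \<open>\<Gamma>(2n + 1) \<cdot> G\<^bsub>2n-\<alpha>\<^esub>\<close>; in particular they agree. The condition \<open>m \<le> 2n\<close> keeps the
  exponent positive before each of the \<open>m\<close> differentiations.

  The analytic heart is the case \<open>y = 1\<close> of the shift for the integral, a Beta integral with a
  logarithm (\<open>LINT_Beta_ln\<close>). The arithmetic one is that the finite alternating sum in the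
  statement is the difference \<open>\<Psi>(2n + 1) - \<Psi>(2n - m + 1)\<close> (\<open>Digamma_add_of_nat\<close>).
\<close>

section \<open>The Beta integral with a logarithm\<close>

lemma abs_ln_le_powr:
  fixes t e :: real
  assumes "0 < t" "t \<le> 1" "0 < e"
  shows "\<bar>ln t\<bar> \<le> t powr (- e) / e"
proof -
  have "ln (1 / t) \<le> (1 / t) powr e / e"
    using assms by (intro ln_powr_bound) auto
  then show ?thesis
    using assms by (simp add: ln_div powr_minus powr_divide field_simps)
qed

lemma
  fixes a b :: real
  assumes "0 < a" "0 < b"
  shows set_integrable_Beta:
      "set_integrable lborel {0..1} (\<lambda>t. t powr (a - 1) * (1 - t) powr (b - 1))"
    and LINT_Beta: "(LINT t:{0..1}|lborel. t powr (a - 1) * (1 - t) powr (b - 1)) = Beta a b"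
proof -
  show *: "set_integrable lborel {0..1} (\<lambda>t. t powr (a - 1) * (1 - t) powr (b - 1))"
    using assms by (rule integrable_Beta)
  show "(LINT t:{0..1}|lborel. t powr (a - 1) * (1 - t) powr (b - 1)) = Beta a b"
    using has_integral_Beta_real[OF assms] set_borel_integral_eq_integral(2)[OF *]
    by (simp add: integral_unique)
qed

text \<open>
  The logarithm costs an arbitrarily small power at the origin, and \<open>a > 0\<close> leaves room for one.
\<close>
lemma set_integrable_Beta_ln:
  fixes a b :: real
  assumes "0 < a" "0 < b"
  shows "set_integrable lborel {0..1} (\<lambda>t. t powr (a - 1) * (1 - t) powr (b - 1) * ln t)"
proof (rule set_integrable_bound)
  show "set_integrable lborel {0..1}
          (\<lambda>t. t powr (a / 2 - 1) * (1 - t) powr (b - 1) * (2 / a))"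
    using set_integrable_Beta[of "a / 2" b] assms by (intro set_integrable_mult_left) auto
  show "set_borel_measurable lborel {0..1} (\<lambda>t. t powr (a - 1) * (1 - t) powr (b - 1) * ln t)"
    unfolding set_borel_measurable_def by measurable
  have "norm (t powr (a - 1) * (1 - t) powr (b - 1) * ln t)
          \<le> norm (t powr (a / 2 - 1) * (1 - t) powr (b - 1) * (2 / a))"
    if "t \<in> {0..1}" for t
  proof (cases "t = 0")
    case False
    with that have t: "0 < t" "t \<le> 1" by auto
    have "t powr (a - 1) * \<bar>ln t\<bar> \<le> t powr (a - 1) * (t powr (- (a / 2)) / (a / 2))"
      using t assms by (intro mult_left_mono abs_ln_le_powr) auto
    also have "\<dots> = t powr (a / 2 - 1) * (2 / a)"
      using t by (simp add: powr_add[symmetric])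
    finally have "(1 - t) powr (b - 1) * (t powr (a - 1) * \<bar>ln t\<bar>)
        \<le> (1 - t) powr (b - 1) * (t powr (a / 2 - 1) * (2 / a))"
      by (intro mult_left_mono) auto
    then show ?thesis
      using assms by (simp add: abs_mult mult_ac)
  qed auto
  then show "AE t in lborel. t \<in> {0..1} \<longrightarrow>
      norm (t powr (a - 1) * (1 - t) powr (b - 1) * ln t)
        \<le> norm (t powr (a / 2 - 1) * (1 - t) powr (b - 1) * (2 / a))"
    by auto
qed

text \<open>
  The right-hand side is the derivative of \<open>Beta a b\<close> in \<open>a\<close>. Convexity of the exponential
  replaces differentiation under the integral sign: from \<open>t\<^sup>h \<ge> 1 + h ln t\<close>, which holds for
  either sign of \<open>h\<close>, the function \<open>h \<mapsto> Beta (a + h) b - h J\<close>, where \<open>J\<close> is the integral,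
  has a minimum at \<open>h = 0\<close>, so \<open>J\<close> must be the derivative of \<open>Beta\<close> there.
\<close>
lemma LINT_Beta_ln:
  fixes a b :: real
  assumes "0 < a" "0 < b"
  shows "(LINT t:{0..1}|lborel. t powr (a - 1) * (1 - t) powr (b - 1) * ln t)
           = Beta a b * (Digamma a - Digamma (a + b))"
proof -
  define J where "J = (LINT t:{0..1}|lborel. t powr (a - 1) * (1 - t) powr (b - 1) * ln t)"
  have tangent: "Beta a b + h * J \<le> Beta (a + h) b" if "\<bar>h\<bar> < a" for h
  proof -
    have h: "0 < a + h" using that by auto
    let ?w = "\<lambda>t::real. t powr (a - 1) * (1 - t) powr (b - 1)"
    have "Beta a b + h * J = (LINT t:{0..1}|lborel. ?w t + h * (?w t * ln t))"
      unfolding J_def LINT_Beta[OF assms, symmetric]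
      using set_integrable_Beta[OF assms] set_integrable_Beta_ln[OF assms]
      by (subst set_integral_add) auto
    also have "\<dots> \<le> (LINT t:{0..1}|lborel. t powr (a + h - 1) * (1 - t) powr (b - 1))"
    proof (rule set_integral_mono)
      show "set_integrable lborel {0..1} (\<lambda>t. ?w t + h * (?w t * ln t))"
        using set_integrable_Beta[OF assms] set_integrable_Beta_ln[OF assms]
        by (intro set_integral_add set_integrable_mult_right) auto
      show "set_integrable lborel {0..1} (\<lambda>t. t powr (a + h - 1) * (1 - t) powr (b - 1))"
        using set_integrable_Beta[OF h assms(2)] .
      show "?w t + h * (?w t * ln t) \<le> t powr (a + h - 1) * (1 - t) powr (b - 1)"
        if "t \<in> {0..1}" for t
      proof (cases "t = 0")
        case False
        with that have t: "0 < t" by auto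
        have "1 + h * ln t \<le> t powr h"
          using t exp_ge_add_one_self[of "h * ln t"] by (simp add: powr_def)
        then have "?w t * (1 + h * ln t) \<le> ?w t * t powr h"
          by (intro mult_left_mono) auto
        also have "\<dots> = t powr (a + h - 1) * (1 - t) powr (b - 1)"
          using t by (simp add: powr_add powr_diff field_simps)
        finally show ?thesis by (simp add: algebra_simps)
      qed auto
    qed
    also have "\<dots> = Beta (a + h) b"
      by (rule LINT_Beta[OF h assms(2)])
    finally show ?thesis .
  qed
  have "a \<notin> \<int>\<^sub>\<le>\<^sub>0" "a + b \<notin> \<int>\<^sub>\<le>\<^sub>0"
    using assms by (auto elim!: nonpos_Ints_cases)
  then have "((\<lambda>x. Beta x b) has_real_derivative Beta a b * (Digamma a - Digamma (a + b)))
      (at (0 + a))"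
    by (auto intro: has_field_derivative_Beta1)
  then have "((\<lambda>h. Beta (a + h) b) has_real_derivative
      Beta a b * (Digamma a - Digamma (a + b))) (at 0)"
    using DERIV_shift[of "\<lambda>x. Beta x b" _ 0 a] by (simp add: add.commute)
  then have "((\<lambda>h. Beta (a + h) b - h * J) has_real_derivative
          Beta a b * (Digamma a - Digamma (a + b)) - J) (at 0)"
    by (auto intro!: derivative_eq_intros)
  then have "Beta a b * (Digamma a - Digamma (a + b)) - J = 0"
    by (rule DERIV_local_min[OF _ assms(1)]) (use tangent in \<open>auto simp: algebra_simps\<close>)
  then show ?thesis by (simp add: J_def)
qed

section \<open>Logarithmic powers under integration and differentiation\<close>

text \<open>
  The free summand \<open>A\<close> adds a multiple of the normalised power \<open>y\<^sup>c / \<Gamma>(c + 1)\<close>. It is unaffected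
  by the shifts in \<open>c\<close>, so one family covers the spline, where \<open>A\<close> cancels the \<open>\<Psi>\<close>-term, and
  all its images.
\<close>
definition log_power :: "real \<Rightarrow> real \<Rightarrow> real \<Rightarrow> real" where
  "log_power A c y = y powr c / Gamma (c + 1) * (ln y - Digamma (c + 1) + A)"

lemma power_mult_ln_eq_log_power:
  assumes "0 < y"
  shows "y ^ k * ln y = Gamma (real k + 1) * log_power (Digamma (real k + 1)) (real k) y"
proof -
  have "Gamma (real k + 1) \<noteq> 0" using Gamma_real_pos[of "real k + 1"] by linarith
  then show ?thesis using assms by (simp add: log_power_def powr_realpow)
qed

text \<open>
  The two terms of the product rule combine because \<open>\<Gamma>(c + 1) = c \<Gamma>(c)\<close> and
  \<open>\<Psi>(c + 1) = \<Psi>(c) + 1 / c\<close>: the latter absorbs the derivative of the logarithm.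
\<close>
lemma has_real_derivative_log_power:
  assumes "0 < c" "0 < y"
  shows "(log_power A c has_real_derivative log_power A (c - 1) y) (at y)"
proof -
  have "c \<notin> \<int>\<^sub>\<le>\<^sub>0" using assms by (auto elim!: nonpos_Ints_cases)
  then have G: "Gamma (c + 1) = c * Gamma c" "Digamma (c + 1) = Digamma c + 1 / c"
    using assms by (simp_all add: Gamma_plus1 Digamma_plus1)
  have nz: "Gamma c \<noteq> 0" using Gamma_real_pos[OF assms(1)] by linarith
  have "(log_power A c has_real_derivative
      c * y powr (c - 1) / Gamma (c + 1) * (ln y - Digamma (c + 1) + A)
        + y powr c / Gamma (c + 1) * (1 / y)) (at y)"
    unfolding log_power_def using assms
    by (auto intro!: derivative_eq_intros simp: divide_inverse)
  moreover have "c * y powr (c - 1) / Gamma (c + 1) * (ln y - Digamma (c + 1) + A)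
        + y powr c / Gamma (c + 1) * (1 / y) = log_power A (c - 1) y"
    using assms nz by (simp add: log_power_def G powr_diff) (simp add: divide_simps, simp add: algebra_simps)
  ultimately show ?thesis by simp
qed

lemma funpow_deriv_log_power:
  assumes f: "\<And>y. 0 < y \<Longrightarrow> f y = K * log_power A c y"
    and "real m < c + 1" "0 < y"
  shows "(deriv ^^ m) f y = K * log_power A (c - real m) y"
  using assms(2,3)
proof (induction m arbitrary: y)
  case 0
  then show ?case using f by simp
next
  case (Suc m)
  have "((\<lambda>y. K * log_power A (c - real m) y) has_real_derivative
          K * log_power A (c - real m - 1) y) (at y)"
    using Suc.prems by (intro DERIV_cmult has_real_derivative_log_power) auto
  then have "((deriv ^^ m) f has_real_derivative K * log_power A (c - real m - 1) y) (at y)"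
    by (rule has_field_derivative_transform_within_open[where S = "{0<..}"])
      (use Suc in auto)
  then show ?case
    by (simp add: DERIV_imp_deriv algebra_simps)
qed

text \<open>
  Changing an integrand on a null set may destroy its Borel measurability, but changing it at
  finitely many points does not, and it leaves the integral of any function as it was. This covers iterated \<open>deriv\<close>s, whose
  values at the end point \<open>0\<close> are not controlled.
\<close>
lemma LINT_Icc_cong_interior:
  fixes f g :: "real \<Rightarrow> real"
  assumes "\<And>t. a < t \<Longrightarrow> t < b \<Longrightarrow> f t = g t"
  shows "(LINT t:{a..b}|lborel. f t) = (LINT t:{a..b}|lborel. g t)"
  unfolding set_lebesgue_integral_def
  by (rule integral_discrete_difference[where X = "{a, b}"])
    (use assms in \<open>auto simp: indicator_def\<close>)

text \<open>
  Substituting \<open>\<tau> = y t\<close> splits \<open>ln \<tau>\<close> into \<open>ln y + ln t\<close> and leaves a Beta integral with and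
  without logarithm; the value of the former turns \<open>\<Psi>(c + 1)\<close> into \<open>\<Psi>(c + b + 1)\<close>.
\<close>
lemma RL_integral_log_power:
  assumes "0 < b" "-1 < c" "0 < y"
  shows "RL_integral 0 b (log_power A c) y = log_power A (c + b) y"
proof -
  \<comment> \<open>The Beta weight with first parameter \<open>c + 1\<close>, in the form in which the Beta integrals state it.\<close>
  let ?w = "\<lambda>t::real. t powr (c + 1 - 1) * (1 - t) powr (b - 1)"
  define C where "C = y powr (c + b) / Gamma (c + 1)"
  define L where "L = ln y - Digamma (c + 1) + A"
  have c: "0 < c + 1" using assms by simp
  have "(LINT \<tau>:{0..y}|lborel. (y - \<tau>) powr (b - 1) * log_power A c \<tau>)
      = y * (LINT t:{0..1}|lborel. (y - y * t) powr (b - 1) * log_power A c (y * t))"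
    unfolding set_lebesgue_integral_def
    using assms
    by (subst lborel_integral_real_affine[where c = y and t = 0])
      (auto intro!: Bochner_Integration.integral_cong
        simp: indicator_def zero_le_mult_iff mult_le_cancel_left1)
  also have "\<dots> = (LINT t:{0..1}|lborel.
      y * ((y - y * t) powr (b - 1) * log_power A c (y * t)))"
    by simp
  also have "\<dots> = (LINT t:{0..1}|lborel. (C * L) * ?w t + C * (?w t * ln t))"
  proof (rule LINT_Icc_cong_interior)
    fix t :: real assume t: "0 < t" "t < 1"
    have "(y - y * t) powr (b - 1) = y powr (b - 1) * (1 - t) powr (b - 1)"
      using assms t by (simp add: powr_mult[symmetric] algebra_simps)
    moreover have "y powr (c + b) = y * (y powr (b - 1) * y powr c)"
      using assms by (simp add: powr_diff powr_add)
    ultimately show "y * ((y - y * t) powr (b - 1) * log_power A c (y * t))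
        = (C * L) * ?w t + C * (?w t * ln t)"
      using assms t unfolding C_def L_def log_power_def
      by (simp add: powr_mult ln_mult) (simp add: algebra_simps add_divide_distrib diff_divide_distrib)
  qed
  also have "\<dots> = C * L * Beta (c + 1) b
      + C * (Beta (c + 1) b * (Digamma (c + 1) - Digamma (c + 1 + b)))"
    using set_integrable_Beta[OF c assms(1)] set_integrable_Beta_ln[OF c assms(1)]
    by (subst set_integral_add)
      (auto simp only: LINT_Beta[OF c assms(1)] LINT_Beta_ln[OF c assms(1)]
        set_integral_mult_right intro!: set_integrable_mult_right)
  finally have "(LINT \<tau>:{0..y}|lborel. (y - \<tau>) powr (b - 1) * log_power A c \<tau>)
      = C * Beta (c + 1) b * (ln y - Digamma (c + 1 + b) + A)"
    by (simp add: L_def algebra_simps)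
  moreover have "Gamma b > 0" "Gamma (c + 1) > 0"
    using assms by auto
  ultimately show ?thesis
    by (simp add: RL_integral_def log_power_def C_def Beta_def add_ac)
qed

section \<open>A finite sum for differences of the digamma function\<close>

text \<open>
  Reversing the order of summation turns the sum, up to a factorial factor, into an alternating
  partial row sum of binomial coefficients, \<open>\<Sum>j\<le>m. (-1)\<^sup>j (N choose j)\<close> with \<open>N = m + 1 + k\<close>,
  whose value is \<open>(-1)\<^sup>m (N - 1 choose m)\<close>.
\<close>
lemma sum_alternating_inverse_fact:
  "(\<Sum>r=1..Suc m. (-1) ^ (r - 1) * (fact m * fact k) / (fact (Suc m - r) * fact (k + r)))
     = (1 / real (m + k + 1) :: real)"
proof -
  define N where "N = m + 1 + k"
  have "(\<Sum>r=1..Suc m. (-1) ^ (r - 1) * (fact m * fact k) / (fact (Suc m - r) * fact (k + r)))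
     = (\<Sum>j\<le>m. (-1) ^ (m - j) * (fact m * fact k) / (fact j * fact (N - j)) :: real)"
    by (rule sum.reindex_bij_witness[of _ "\<lambda>j. Suc m - j" "\<lambda>r. Suc m - r"])
      (auto simp: N_def Suc_diff_le)
  also have "\<dots> = (\<Sum>j\<le>m. (-1) ^ m * (fact m * fact k) / fact N * ((real N gchoose j) * (-1) ^ j))"
  proof (rule sum.cong)
    fix j assume j: "j \<in> {..m}"
    then have "real N gchoose j = fact N / (fact j * fact (N - j))"
      using binomial_gbinomial[of N j, where ?'a = real] binomial_fact[of j N, where ?'a = real]
      by (simp add: N_def)
    moreover have "(-1 :: real) ^ (m - j) = (-1) ^ m * (-1) ^ j"
      using j by (cases "even m"; cases "even j") auto
    ultimately show "(-1) ^ (m - j) * (fact m * fact k) / (fact j * fact (N - j))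
        = (-1) ^ m * (fact m * fact k) / fact N * ((real N gchoose j) * (-1) ^ j)"
      by (simp add: field_simps)
  qed simp
  also have "\<dots> = (-1) ^ m * (fact m * fact k) / fact N * ((-1) ^ m * (real N - 1 gchoose m))"
    by (simp only: sum_distrib_left[symmetric] gbinomial_sum_lower_neg)
  also have "real N - 1 gchoose m = fact (m + k) / (fact m * fact k)"
    using binomial_gbinomial[of "m + k" m, where ?'a = real, symmetric]
    by (simp add: N_def binomial_fact)
  also have "(-1) ^ m * (fact m * fact k) / fact N
      * ((-1) ^ m * (fact (m + k) / (fact m * fact k))) = (1 / real (m + k + 1) :: real)"
    by (simp add: N_def divide_simps flip: power_mult_distrib)
  finally show ?thesis .
qed

text \<open>
  Induction on \<open>m\<close>. After putting the \<open>r\<close>-th summands for \<open>m + 1\<close> and for \<open>m\<close> over a common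
  denominator, their difference carries the factor \<open>(m + 1) - (m + 1 - r) = r\<close>, which cancels the
  \<open>r\<close> below. The differences then add up to \<open>1 / (m + k + 1)\<close> by
  \<open>sum_alternating_inverse_fact\<close>, and this is the increment of \<open>\<Psi>\<close>.
\<close>
lemma Digamma_add_of_nat:
  "Digamma (real (m + k) + 1) = Digamma (real k + 1) + fact m * Gamma (real k + 1) *
     (\<Sum>r=1..m. (-1) ^ (r - 1) / (real r * fact (m - r) * Gamma (real k + real r + 1)))"
proof (induction m)
  case 0
  then show ?case by simp
next
  case (Suc m)
  let ?s = "\<lambda>m r. (-1) ^ (r - 1) * (fact m * fact k) / (real r * fact (m - r) * fact (k + r)) :: real"
  have Gamma_eq: "Gamma (real k + real r + 1) = fact (k + r)" "Gamma (real k + 1) = fact k" for r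
    using Gamma_fact[of "k + r", where ?'a = real] Gamma_fact[of k, where ?'a = real]
    by (simp_all add: add_ac)
  have sum_eq: "fact m * Gamma (real k + 1) *
     (\<Sum>r=1..m. (-1) ^ (r - 1) / (real r * fact (m - r) * Gamma (real k + real r + 1)))
     = (\<Sum>r=1..m. ?s m r)" for m
    by (simp add: Gamma_eq sum_distrib_left mult_ac)
  have step: "?s (Suc m) r = ?s m r
      + (-1) ^ (r - 1) * (fact m * fact k) / (fact (Suc m - r) * fact (k + r))"
    if "r \<in> {1..m}" for r
  proof -
    have "fact (Suc m - r) = (real m + 1 - real r) * fact (m - r)"
      using that by (simp add: Suc_diff_le of_nat_diff algebra_simps)
    moreover have "real m + 1 - real r \<noteq> 0" "real r \<noteq> 0" using that by auto
    ultimately show ?thesis by (simp add: divide_simps) (simp add: algebra_simps)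
  qed
  have top: "?s (Suc m) (Suc m)
      = (-1) ^ (Suc m - 1) * (fact m * fact k) / (fact (Suc m - Suc m) * fact (k + Suc m))"
    by (simp add: divide_simps)
  have "(\<Sum>r=1..Suc m. ?s (Suc m) r) = (\<Sum>r=1..m. ?s m r)
      + (\<Sum>r=1..Suc m. (-1) ^ (r - 1) * (fact m * fact k) / (fact (Suc m - r) * fact (k + r)))"
    using step top by (simp add: sum.distrib)
  also have "\<dots> = (\<Sum>r=1..m. ?s m r) + 1 / real (m + k + 1)"
    by (simp only: sum_alternating_inverse_fact)
  also have "1 / real (m + k + 1) = Digamma (real (Suc m + k) + 1) - Digamma (real (m + k) + 1)"
    using Digamma_plus1[of "real (m + k) + 1"] by (simp add: add_ac)
  finally show ?case
    using Suc.IH unfolding sum_eq by simp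
qed

section \<open>Fractional operators on the thin-plate spline\<close>

lemma less_nat_ceiling:
  fixes \<alpha> :: real
  assumes "\<alpha> \<notin> \<int>"
  shows "\<alpha> < real (nat \<lceil>\<alpha>\<rceil>)"
  using assms real_nat_ceiling_ge[of \<alpha>] by (metis Ints_of_nat less_eq_real_def)

lemma RL_integral_power_ln:
  assumes "0 < b" "0 < y"
  shows "RL_integral 0 b (\<lambda>\<tau>. \<tau> ^ k * ln \<tau>) y
    = Gamma (real k + 1) * log_power (Digamma (real k + 1)) (real k + b) y"
proof -
  let ?A = "Digamma (real k + 1)"
  have "RL_integral 0 b (\<lambda>\<tau>. \<tau> ^ k * ln \<tau>) y
      = 1 / Gamma b * (LINT \<tau>:{0..y}|lborel. Gamma (real k + 1) *
          ((y - \<tau>) powr (b - 1) * log_power ?A (real k) \<tau>))"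
    unfolding RL_integral_def
    by (rule arg_cong2[where f = "(*)"], rule refl, rule LINT_Icc_cong_interior)
      (simp add: power_mult_ln_eq_log_power)
  also have "\<dots> = Gamma (real k + 1) * RL_integral 0 b (log_power ?A (real k)) y"
    by (simp add: RL_integral_def)
  finally show ?thesis
    using assms by (simp add: RL_integral_log_power)
qed

lemma Caputo_deriv_power_ln:
  assumes "\<alpha> \<notin> \<int>" "m = nat \<lceil>\<alpha>\<rceil>" "m \<le> k" "0 < x"
  shows "Caputo_deriv 0 \<alpha> (\<lambda>\<tau>. \<tau> ^ k * ln \<tau>) x
    = Gamma (real k + 1) * log_power (Digamma (real k + 1)) (real k - \<alpha>) x"
proof -
  let ?A = "Digamma (real k + 1)"
  have b: "0 < real m - \<alpha>"
    using less_nat_ceiling[OF assms(1)] assms(2) by simp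
  have D: "(deriv ^^ m) (\<lambda>\<tau>. \<tau> ^ k * ln \<tau>) y
      = Gamma (real k + 1) * log_power ?A (real k - real m) y" if "0 < y" for y
    using that assms(3) by (intro funpow_deriv_log_power power_mult_ln_eq_log_power) auto
  have "Caputo_deriv 0 \<alpha> (\<lambda>\<tau>. \<tau> ^ k * ln \<tau>) x
      = 1 / Gamma (real m - \<alpha>) * (LINT \<tau>:{0..x}|lborel. Gamma (real k + 1) *
          ((x - \<tau>) powr (real m - \<alpha> - 1) * log_power ?A (real k - real m) \<tau>))"
    unfolding Caputo_deriv_def Let_def assms(2)[symmetric]
    by (rule arg_cong2[where f = "(*)"], rule refl, rule LINT_Icc_cong_interior) (simp add: D)
  also have "\<dots> = Gamma (real k + 1) *
      RL_integral 0 (real m - \<alpha>) (log_power ?A (real k - real m)) x"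
    by (simp add: RL_integral_def)
  finally show ?thesis
    using assms b by (simp add: RL_integral_log_power)
qed

lemma RL_deriv_power_ln:
  assumes "\<alpha> \<notin> \<int>" "m = nat \<lceil>\<alpha>\<rceil>" "m \<le> k" "0 < x"
  shows "RL_deriv 0 \<alpha> (\<lambda>\<tau>. \<tau> ^ k * ln \<tau>) x
    = Gamma (real k + 1) * log_power (Digamma (real k + 1)) (real k - \<alpha>) x"
proof -
  let ?A = "Digamma (real k + 1)" and ?b = "real m - \<alpha>"
  have b: "0 < ?b"
    using less_nat_ceiling[OF assms(1)] assms(2) by simp
  have pos: "0 < Gamma ?b" using b by simp
  have "(deriv ^^ m) (\<lambda>y. LINT \<tau>:{0..y}|lborel. (y - \<tau>) powr (?b - 1) * (\<tau> ^ k * ln \<tau>)) x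
      = (Gamma ?b * Gamma (real k + 1)) * log_power ?A (real k + ?b - real m) x"
  proof (rule funpow_deriv_log_power)
    fix y :: real assume "0 < y"
    from RL_integral_power_ln[OF b this, of k] pos
    show "(LINT \<tau>:{0..y}|lborel. (y - \<tau>) powr (?b - 1) * (\<tau> ^ k * ln \<tau>))
        = (Gamma ?b * Gamma (real k + 1)) * log_power ?A (real k + ?b) y"
      by (simp add: RL_integral_def field_simps)
  qed (use assms b in auto)
  then show ?thesis
    using pos by (simp add: RL_deriv_def Let_def flip: assms(2))
qed

theorem theorem14:
  fixes \<alpha> x :: real and m n :: nat
  assumes "\<alpha> > 0" and "\<alpha> \<notin> \<int>" and "m = nat \<lceil>\<alpha>\<rceil>" and "x > 0"
  shows "RL_integral 0 \<alpha> (\<lambda>\<tau>. \<tau> ^ (2 * n) * ln \<tau>) x =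
           Gamma (2 * real n + 1) / Gamma (2 * real n + 1 + \<alpha>) * x powr (\<alpha> + 2 * real n) *
           (ln x + Digamma (2 * real n + 1) - Digamma (2 * real n + 1 + \<alpha>)) \<and>
         (m \<le> 2 * n \<longrightarrow>
         Caputo_deriv 0 \<alpha> (\<lambda>\<tau>. \<tau> ^ (2 * n) * ln \<tau>) x =
           Gamma (2 * real n + 1) / Gamma (2 * real n + 1 - \<alpha>) * x powr (2 * real n - \<alpha>) *
           (ln x + Digamma (2 * real n - real m + 1) - Digamma (2 * real n + 1 - \<alpha>) +
            fact m * Gamma (2 * real n - real m + 1) *
            (\<Sum>r=1..m. (-1) ^ (r - 1) /
               (real r * fact (m - r) * Gamma (2 * real n - real m + real r + 1))))) \<and>
         (m \<le> 2 * n \<longrightarrow>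
         RL_deriv 0 \<alpha> (\<lambda>\<tau>. \<tau> ^ (2 * n) * ln \<tau>) x =
           Gamma (2 * real n + 1) / Gamma (2 * real n + 1 - \<alpha>) * x powr (2 * real n - \<alpha>) *
           (ln x + Digamma (2 * real n - real m + 1) - Digamma (2 * real n + 1 - \<alpha>) +
            fact m * Gamma (2 * real n - real m + 1) *
            (\<Sum>r=1..m. (-1) ^ (r - 1) /
               (real r * fact (m - r) * Gamma (2 * real n - real m + real r + 1)))))"
proof (intro conjI impI)
  show "RL_integral 0 \<alpha> (\<lambda>\<tau>. \<tau> ^ (2 * n) * ln \<tau>) x =
           Gamma (2 * real n + 1) / Gamma (2 * real n + 1 + \<alpha>) * x powr (\<alpha> + 2 * real n) *
           (ln x + Digamma (2 * real n + 1) - Digamma (2 * real n + 1 + \<alpha>))"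
    using RL_integral_power_ln[OF assms(1,4), of "2 * n"]
    by (simp add: log_power_def add_ac)
next
  assume "m \<le> 2 * n"
  then have "Digamma (2 * real n + 1) = Digamma (2 * real n - real m + 1) +
      fact m * Gamma (2 * real n - real m + 1) * (\<Sum>r=1..m. (-1) ^ (r - 1) /
        (real r * fact (m - r) * Gamma (2 * real n - real m + real r + 1)))"
    using Digamma_add_of_nat[of m "2 * n - m"] by (simp add: of_nat_diff)
  then have value_eq: "Gamma (2 * real n + 1) * log_power (Digamma (2 * real n + 1)) (2 * real n - \<alpha>) x =
      Gamma (2 * real n + 1) / Gamma (2 * real n + 1 - \<alpha>) * x powr (2 * real n - \<alpha>) *
      (ln x + Digamma (2 * real n - real m + 1) - Digamma (2 * real n + 1 - \<alpha>) +
       fact m * Gamma (2 * real n - real m + 1) *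
       (\<Sum>r=1..m. (-1) ^ (r - 1) /
          (real r * fact (m - r) * Gamma (2 * real n - real m + real r + 1))))"
    by (simp add: log_power_def algebra_simps)
  show "Caputo_deriv 0 \<alpha> (\<lambda>\<tau>. \<tau> ^ (2 * n) * ln \<tau>) x =
           Gamma (2 * real n + 1) / Gamma (2 * real n + 1 - \<alpha>) * x powr (2 * real n - \<alpha>) *
           (ln x + Digamma (2 * real n - real m + 1) - Digamma (2 * real n + 1 - \<alpha>) +
            fact m * Gamma (2 * real n - real m + 1) *
            (\<Sum>r=1..m. (-1) ^ (r - 1) /
               (real r * fact (m - r) * Gamma (2 * real n - real m + real r + 1))))"
    using Caputo_deriv_power_ln[OF assms(2,3) \<open>m \<le> 2 * n\<close> assms(4)]
    by (simp only: value_eq[symmetric] of_nat_mult of_nat_numeral)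
  show "RL_deriv 0 \<alpha> (\<lambda>\<tau>. \<tau> ^ (2 * n) * ln \<tau>) x =
           Gamma (2 * real n + 1) / Gamma (2 * real n + 1 - \<alpha>) * x powr (2 * real n - \<alpha>) *
           (ln x + Digamma (2 * real n - real m + 1) - Digamma (2 * real n + 1 - \<alpha>) +
            fact m * Gamma (2 * real n - real m + 1) *
            (\<Sum>r=1..m. (-1) ^ (r - 1) /
               (real r * fact (m - r) * Gamma (2 * real n - real m + real r + 1))))"
    using RL_deriv_power_ln[OF assms(2,3) \<open>m \<le> 2 * n\<close> assms(4)]
    by (simp only: value_eq[symmetric] of_nat_mult of_nat_numeral)
qed

end
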